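(* Let $p$ be an odd prime, and let $g, c$ be fixed integers with $p \nmid g$ and $p \nmid c$. Let $m = \operatorname{ord}_p(g)$ and $f(x) = x g^x - c$. Then the number of $x \in \{1, \dots, pm \mid x \not\equiv 0 \pmod p\}$ such that $f(x) \equiv 0 \pmod p$ is equal to $m$, and these solutions are all distinct modulo $m$.
   Context: $\operatorname{ord}_p(g)$ denotes the multiplicative order of $g$ modulo $p$. The notation $\{1,\dots,N \mid x\not\equiv 0 \pmod p\}$ denotes the set of integers $x$ with $1 \le x \le N$ and $p \nmid x$. *)

theory Defs
  imports "HOL-Number_Theory.Number_Theory"
begin

definition congruence_solutions :: "(nat \<Rightarrow> int) \<Rightarrow> nat \<Rightarrow> nat \<Rightarrow> nat set" where
  "congruence_solutions f p N =
     {x \<in> {1..N}. \<not> [x = 0] (mod p) \<and> [f x = 0] (mod int p)}"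

end

theory Submission
  imports Defs
begin

text \<open>
  The residue of \<open>x * g ^ x\<close> modulo \<open>p\<close> depends only on \<open>x\<close> modulo \<open>p\<close> and modulo \<open>m\<close>.
  For every residue \<open>r\<close> modulo \<open>m\<close> the linear congruence \<open>x * g ^ r = c\<close> determines \<open>x\<close>
  modulo \<open>p\<close>. Since \<open>m\<close> divides \<open>p - 1\<close>, it is coprime to \<open>p\<close>, and the Chinese remainder
  theorem yields exactly one solution below \<open>p * m\<close> in each residue class modulo \<open>m\<close>.
\<close>

lemma cong_nat_mod_int:
  fixes k :: int
  assumes "n > 0"
  shows "[int (nat (k mod int n)) = k] (mod int n)"
  using assms by (simp add: cong_def)

text \<open>Serves to pass from an integer base, possibly negative, to a natural representative.
  \<open>ord\<close> is determined by coprimality and by which powers are congruent to 1, and both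
  depend only on the residue class.\<close>

lemma ord_cong_int:
  fixes g :: int
  assumes "[int a = g] (mod int n)"
  shows "ord (int n) g = ord n a"
proof -
  have "[g ^ d = 1] (mod int n) \<longleftrightarrow> [a ^ d = 1] (mod n)" for d
  proof -
    have "[g ^ d = int (a ^ d)] (mod int n)"
      using cong_pow[OF cong_sym[OF assms], of d] by simp
    then have "[g ^ d = 1] (mod int n) \<longleftrightarrow> [int (a ^ d) = int 1] (mod int n)"
      by (simp add: cong_def)
    then show ?thesis
      by (simp only: cong_int_iff)
  qed
  moreover have "coprime (int n) g \<longleftrightarrow> coprime n a"
    using cong_imp_coprime[OF assms] cong_imp_coprime[OF cong_sym[OF assms]]
    by (metis coprime_commute coprime_int_iff)
  ultimately show ?thesis
    by (simp add: ord_def)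
qed

lemma coprime_ord_prime:
  assumes "prime p" "\<not> p dvd a"
  shows "coprime p (ord p a)"
proof -
  have "ord p a dvd p - 1"
    using fermat_theorem[OF assms] by (simp add: ord_divides')
  moreover have "coprime p (p - 1)"
    using prime_gt_0_nat[OF assms(1)] by (rule coprime_diff_one_right_nat)
  ultimately show ?thesis
    by (rule coprime_divisors[OF dvd_refl])
qed

text \<open>A bijection onto the residues modulo \<open>m\<close> gives the count and the
  distinctness modulo \<open>m\<close> at once.\<close>

lemma bij_betw_solutions_mod_ord:
  fixes a c p :: nat
  defines "m \<equiv> ord p a"
  assumes p: "prime p" and a: "\<not> p dvd a" and c: "\<not> p dvd c"
  shows "bij_betw (\<lambda>x. x mod m)
    {x \<in> {1..p * m}. \<not> [x = 0] (mod p) \<and> [x * a ^ x = c] (mod p)} {..<m}"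
    (is "bij_betw _ ?S _")
proof (rule bij_betw_imageI)
  have cop: "coprime p a"
    using p a by (simp add: prime_imp_coprime)
  have m0: "m > 0"
    using cop by (simp add: m_def)
  have p0: "p > 0"
    using p by (rule prime_gt_0_nat)
  have pm: "coprime p m"
    unfolding m_def using p a by (rule coprime_ord_prime)
  have pow_cong: "[a ^ x = a ^ y] (mod p)" if "[x = y] (mod m)" for x y
    using that cop order_divides_expdiff[of p a x y] by (simp add: m_def)
  \<comment> \<open>The endpoint \<open>p * m\<close> is a multiple of \<open>p\<close>, so it is no
    solution; all solutions are then reduced modulo \<open>p * m\<close>, and congruent ones are
    equal.\<close>
  have less: "x < p * m" if "x \<in> ?S" for x
    using that by (cases "x = p * m") (auto simp: cong_0_iff)
  show "inj_on (\<lambda>x. x mod m) ?S"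
  proof (rule inj_onI)
    fix x y assume x: "x \<in> ?S" and y: "y \<in> ?S" and "x mod m = y mod m"
    then have m: "[x = y] (mod m)"
      by (simp add: cong_def)
    have "[x * a ^ x = y * a ^ y] (mod p)"
      using x y by (simp add: cong_def)
    also have "[y * a ^ y = y * a ^ x] (mod p)"
      using pow_cong[OF m] by (intro cong_mult cong_refl) (rule cong_sym)
    finally have "[x = y] (mod p)"
      using cop by (simp add: cong_mult_rcancel_nat coprime_commute)
    then have "[x = y] (mod p * m)"
      using m pm by (rule coprime_cong_mult_nat)
    then show "x = y"
      using less[OF x] less[OF y] by (rule cong_less_modulus_unique_nat)
  qed
  show "(\<lambda>x. x mod m) ` ?S = {..<m}"
  proof
    show "(\<lambda>x. x mod m) ` ?S \<subseteq> {..<m}"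
      using m0 by auto
    show "{..<m} \<subseteq> (\<lambda>x. x mod m) ` ?S"
    proof
      fix r assume r: "r \<in> {..<m}"
      have "coprime (a ^ r) p"
        using cop by (simp add: coprime_commute)
      \<comment> \<open>With \<open>b\<close> inverse to \<open>a ^ r\<close>, the class that
        \<open>x\<close> must have modulo \<open>p\<close> is that of \<open>c * b\<close>.\<close>
      then obtain b where b: "[a ^ r * b = Suc 0] (mod p)"
        using cong_solve_coprime_nat by blast
      obtain x where x: "x < p * m" "[x = c * b] (mod p)" "[x = r] (mod m)"
        using binary_chinese_remainder_unique_nat[OF pm, of "c * b" r] p0 m0 by auto
      have "[x * a ^ x = c * b * a ^ r] (mod p)"
        using x pow_cong by (intro cong_mult) auto
      also have "[c * b * a ^ r = c] (mod p)"
        using cong_mult[OF cong_refl[of c] b] by (simp add: ac_simps)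
      finally have sol: "[x * a ^ x = c] (mod p)" .
      \<comment> \<open>The remainder theorem could return 0, which lies outside the range;
        \<open>p\<close> not dividing \<open>c\<close> rules this out.\<close>
      then have "\<not> p dvd x"
        using c cong_dvd_iff[OF sol] by auto
      moreover from this have "x \<ge> 1"
        by (cases x) auto
      ultimately have "x \<in> ?S"
        using x sol by (simp add: cong_0_iff)
      moreover have "r = x mod m"
        using x(3) r by (simp add: cong_def)
      ultimately show "r \<in> (\<lambda>x. x mod m) ` ?S"
        by blast
    qed
  qed
qed

theorem theorem2:
  fixes p m :: nat and g c :: int and f :: "nat \<Rightarrow> int"
  assumes "prime p" and "odd p"
    and "\<not> int p dvd g" and "\<not> int p dvd c"
    and "m = ord (int p) g"
    and "\<And>x. f x = int x * g ^ x - c"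
  shows "card (congruence_solutions f p (p * m)) = m
    \<and> inj_on (\<lambda>x. x mod m) (congruence_solutions f p (p * m))"
proof -
  have p0: "p > 0"
    using assms(1) by (rule prime_gt_0_nat)
  \<comment> \<open>Only the residues of \<open>g\<close> and \<open>c\<close> modulo
    \<open>p\<close> matter, so both are replaced by natural numbers.\<close>
  define a where "a = nat (g mod int p)"
  define d where "d = nat (c mod int p)"
  have a: "[int a = g] (mod int p)" and d: "[int d = c] (mod int p)"
    unfolding a_def d_def using p0 by (rule cong_nat_mod_int)+
  have m: "m = ord p a"
    using assms(5) ord_cong_int[OF a] by simp
  have na: "\<not> p dvd a" and nd: "\<not> p dvd d"
    using assms(3,4) cong_dvd_iff[OF a] cong_dvd_iff[OF d] by auto
  have "[f x = 0] (mod int p) \<longleftrightarrow> [x * a ^ x = d] (mod p)" for x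
  proof -
    have "[f x = 0] (mod int p) \<longleftrightarrow> [int x * g ^ x = c] (mod int p)"
      by (simp add: assms(6) cong_diff_iff_cong_0)
    also have "\<dots> \<longleftrightarrow> [int (x * a ^ x) = int d] (mod int p)"
    proof -
      have "[int (x * a ^ x) = int x * g ^ x] (mod int p)"
        using cong_mult[OF cong_refl[of "int x"] cong_pow[OF a]] by simp
      then show ?thesis
        using d by (simp add: cong_def)
    qed
    finally show ?thesis
      by (simp only: cong_int_iff)
  qed
  then have "bij_betw (\<lambda>x. x mod m) (congruence_solutions f p (p * m)) {..<m}"
    using bij_betw_solutions_mod_ord[OF assms(1) na nd]
    by (simp add: congruence_solutions_def m)
  then show ?thesis
    using bij_betw_same_card bij_betw_imp_inj_on by (metis card_lessThan)
qed

end
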